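(* Let $\beta>1$ and let $X$ be a random variable with density $f_\beta(x)=C_\beta(1+x^2)^{-\beta}$, $x\in\mathbb R$. Then for every $\alpha$ with $1<\alpha<\beta$ and every bounded smooth $\phi:\mathbb R\to\mathbb R$ such that $\phi(X)$ has finite entropy, $$\mathrm{Ent}[\phi^2(X)]\le \frac{2}{\rho_{\beta,\alpha}}\,E\big\{(1+X^2)^\alpha[\phi'(X)]^2\big\},$$ where $$\rho_{\beta,\alpha}=\begin{cases}(2\beta-\alpha)\Big(\dfrac{\alpha-1}{2-\alpha}\Big)^{3-2\alpha}, & 1<\alpha<\tfrac32,\\[2mm] 2\beta-\alpha, & \tfrac32\le\alpha<\beta .\end{cases}$$
   Context: $C_\beta>0$ is the normalizing constant making $f_\beta$ a probability density. For a random variable $X$ with density $f$ on an interval $\mathcal I$, $\mathrm{Ent}[\phi^2(X)]=\int_{\mathcal I}\phi^2\log\phi^2\,f\,dx-\Big(\int_{\mathcal I}\phi^2 f\,dx\Big)\log\Big(\int_{\mathcal I}\phi^2 f\,dx\Big)$. *)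

theory Defs
  imports "HOL-Analysis.Analysis"
begin

definition C_beta :: "real \<Rightarrow> real" where
  "C_beta \<beta> = 1 / (\<integral>x. (1 + x\<^sup>2) powr (-\<beta>) \<partial>lborel)"

definition f_beta :: "real \<Rightarrow> real \<Rightarrow> real" where
  "f_beta \<beta> x = C_beta \<beta> * (1 + x\<^sup>2) powr (-\<beta>)"

definition smooth_real :: "(real \<Rightarrow> real) \<Rightarrow> bool" where
  "smooth_real g \<longleftrightarrow> (\<forall>n x. ((deriv ^^ n) g) differentiable (at x))"

text \<open>Entropy of g(X) (here g = phi^2) for X with density f on the real line.
  Note ln 0 = 0 in Isabelle, matching the convention 0 log 0 = 0.\<close>
definition Ent :: "(real \<Rightarrow> real) \<Rightarrow> (real \<Rightarrow> real) \<Rightarrow> real" where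
  "Ent f g = (\<integral>x. g x * ln (g x) * f x \<partial>lborel)
     - (\<integral>x. g x * f x \<partial>lborel) * ln (\<integral>x. g x * f x \<partial>lborel)"

definition finite_entropy :: "(real \<Rightarrow> real) \<Rightarrow> (real \<Rightarrow> real) \<Rightarrow> bool" where
  "finite_entropy f g \<longleftrightarrow> integrable lborel (\<lambda>x. g x * ln (g x) * f x)
     \<and> integrable lborel (\<lambda>x. g x * f x)"

definition rho :: "real \<Rightarrow> real \<Rightarrow> real" where
  "rho \<beta> \<alpha> = (if \<alpha> < 3/2 then (2*\<beta> - \<alpha>) * ((\<alpha> - 1) / (2 - \<alpha>)) powr (3 - 2*\<alpha>)
               else 2*\<beta> - \<alpha>)"

end

theory Submission
  imports Defs
begin

text \<open>
  Mass transport in dimension one, after Cordero-Erausquin. In the coordinate \<open>y = Y(x)\<close> with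
  \<open>Y' = (1 + x\<^sup>2) powr (-\<alpha>/2)\<close> the weighted Dirichlet form becomes the ordinary one, the law of \<open>X\<close> becomes
  \<open>m = exp (-V)\<close> on a bounded interval, and \<open>V'' \<ge> \<rho>\<close> by weighted AM-GM. For a
  positive density \<open>h\<close> with respect to the law of \<open>X\<close>, let \<open>S\<close> be the monotone map transporting
  \<open>h f dx\<close> to \<open>f dx\<close>, and \<open>\<theta> = Y \<circ> S - Y\<close>. Taking logarithms in the change of variables
  formula, and using \<open>ln \<tau> \<le> \<tau> - 1\<close> and strong convexity of \<open>V\<close>, gives pointwise
  \<open>h ln h f \<le> (m h \<theta>)' - m h' \<theta> - \<rho>/2 \<theta>\<^sup>2 h f\<close>. Completing the square leaves the Fisher information
  integrand, and the exact derivative integrates to zero because \<open>h \<theta>\<close> is bounded and \<open>m\<close> vanishes at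
  infinity. The theorem follows for \<open>h\<close> proportional to \<open>\<phi>\<^sup>2 + \<epsilon>\<close>, letting \<open>\<epsilon>\<close> tend to \<open>0\<close>.
\<close>

section \<open>Integrability and primitives on the real line\<close>

lemma integrable_one_plus_square_powr:
  fixes \<gamma> :: real
  assumes "\<gamma> > 1/2"
  shows "integrable lborel (\<lambda>x::real. (1 + x\<^sup>2) powr (-\<gamma>))"
proof -
  let ?t = "\<lambda>x::real. indicator {1..} x *\<^sub>R x powr (-2*\<gamma>)"
  have "(\<lambda>x::real. x powr (-2*\<gamma>)) integrable_on {1..}"
    using has_integral_powr_to_inf[of "-2*\<gamma>" 1] assms by auto
  then have "(\<lambda>x::real. x powr (-2*\<gamma>)) absolutely_integrable_on {1..}"
    by (rule nonnegative_absolutely_integrable_1) simp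
  then have T: "integrable lborel ?t"
    unfolding set_integrable_def by (subst (asm) integrable_completion) auto
  have T': "integrable lborel (\<lambda>x. ?t (0 + (-1) * x))"
    by (rule lborel_integrable_real_affine[OF T]) simp
  \<comment> \<open>The majorant is 1 on the middle interval and
    \<open>\<bar>x\<bar> powr (-2*\<gamma>)\<close> on each tail, the left tail being the reflection
    of the right one.\<close>
  have I: "integrable lborel (\<lambda>x::real. indicator {-1..1} x :: real)"
    by simp
  have "integrable lborel (\<lambda>x. indicator {-1..1} x + (?t x + ?t (0 + (-1) * x)))"
    by (intro Bochner_Integration.integrable_add T T' I)
  then show ?thesis
  proof (rule Bochner_Integration.integrable_bound)
    show "AE x in lborel. norm ((1 + x\<^sup>2) powr (-\<gamma>))
        \<le> norm (indicator {-1..1} x + (?t x + ?t (0 + (-1) * x)))"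
    proof (rule AE_I2)
      fix x :: real
      have 1: "(1 + x\<^sup>2) powr (-\<gamma>) \<le> 1"
        using powr_mono2'[of "-\<gamma>" 1 "1+x\<^sup>2"] assms by simp
      have 2: "(1 + x\<^sup>2) powr (-\<gamma>) \<le> \<bar>x\<bar> powr (-2*\<gamma>)" if "1 \<le> \<bar>x\<bar>"
      proof -
        have "(1 + x\<^sup>2) powr (-\<gamma>) \<le> (\<bar>x\<bar>^2) powr (-\<gamma>)"
          using that assms by (intro powr_mono2') auto
        also have "\<dots> = (\<bar>x\<bar> powr 2) powr (-\<gamma>)" using that by simp
        also have "\<dots> = \<bar>x\<bar> powr (-2*\<gamma>)" by (subst powr_powr) simp
        finally show ?thesis .
      qed
      show "norm ((1 + x\<^sup>2) powr (-\<gamma>))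
        \<le> norm (indicator {-1..1} x + (?t x + ?t (0 + (-1) * x)))"
        using 1 2 by (auto simp: indicator_def abs_if split: if_splits)
    qed
  qed auto
qed

text \<open>The primitive is the integral over the half-line up to x. It serves as a distribution
  function in the transport, as the coordinate \<open>Y\<close>, and as the device that turns an
  integral into a limit of increments.\<close>

lemma continuous_integrable_antiderivative:
  fixes u :: "real \<Rightarrow> real"
  assumes cont: "continuous_on UNIV u" and int: "integrable lborel u"
  obtains F where "\<And>x. (F has_real_derivative u x) (at x)"
    and "(F \<longlongrightarrow> 0) at_bot" and "(F \<longlongrightarrow> integral\<^sup>L lborel u) at_top"
proof -
  have si: "set_integrable lborel A u" if "A \<in> sets borel" for A
    unfolding set_integrable_def using that int by (intro integrable_mult_indicator) auto
  have meas [measurable]: "u \<in> borel_measurable borel"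
    using borel_measurable_integrable[OF int] by simp
  define F where "F = (\<lambda>x. LINT t:{..x}|lborel. u t)"
  have split: "F b = F a + (LINT t:{a..b}|lborel. u t)" if "a \<le> b" for a b
  proof -
    have "F b = (LINT t:{..a} \<union> {a<..b}|lborel. u t)"
      unfolding F_def using that by (simp add: ivl_disj_un_one(3))
    also have "\<dots> = F a + (LINT t:{a<..b}|lborel. u t)"
      unfolding F_def by (intro set_integral_Un si) auto
    also have "(LINT t:{a<..b}|lborel. u t) = (LINT t:{a..b}|lborel. u t)"
    proof (rule set_integral_cong_set)
      show "AE x in lborel. (x \<in> {a..b}) = (x \<in> {a<..b})"
        using AE_lborel_singleton[of a] by eventually_elim auto
    qed (use meas in \<open>auto simp: set_borel_measurable_def\<close>)
    finally show ?thesis .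
  qed
  have D: "(F has_real_derivative u x) (at x)" for x
  proof -
    have "((\<lambda>y. F (x-1) + integral {x-1..y} u) has_real_derivative u x) (at x within {x-1..x+1})"
      using integral_has_real_derivative[of "x-1" "x+1" u x] cont
      by (auto intro!: derivative_eq_intros continuous_on_subset[OF cont])
    then have "((\<lambda>y. F (x-1) + integral {x-1..y} u) has_real_derivative u x) (at x)"
      by (simp add: at_within_Icc_at)
    then show ?thesis
    proof (rule DERIV_cong_ev[THEN iffD1, rotated -1])
      have "eventually (\<lambda>y. y \<in> {x-1<..}) (nhds x)"
        by (intro eventually_nhds_in_open) auto
      then show "\<forall>\<^sub>F y in nhds x. F (x-1) + integral {x-1..y} u = F y"
        by eventually_elim
          (simp add: set_borel_integral_eq_integral(2)[OF si, symmetric], rule split[symmetric], simp)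
    qed auto
  qed
  have top: "((\<lambda>b. F 0 + (LINT t:{0..b}|lborel. u t)) \<longlongrightarrow> F 0 + (LINT t:{0..}|lborel. u t)) at_top"
    by (intro tendsto_intros tendsto_set_lebesgue_integral_at_top si) auto
  have "(LINT t:{0..}|lborel. u t) = (LINT t:{0<..}|lborel. u t)"
    proof (rule set_integral_cong_set)
      show "AE x in lborel. (x \<in> {0<..}) = (x \<in> {0::real..})"
        using AE_lborel_singleton[of 0] by eventually_elim auto
    qed (use meas in \<open>auto simp: set_borel_measurable_def\<close>)
  then have "F 0 + (LINT t:{0..}|lborel. u t) = (LINT t:{..0} \<union> {0<..}|lborel. u t)"
    unfolding F_def by (subst set_integral_Un) (auto intro: si)
  also have "{..0} \<union> {0<..} = (UNIV :: real set)" by auto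
  finally have tot: "F 0 + (LINT t:{0..}|lborel. u t) = integral\<^sup>L lborel u"
    by (simp add: set_lebesgue_integral_def)
  have 1: "(F \<longlongrightarrow> integral\<^sup>L lborel u) at_top"
    using top unfolding tot
  proof (rule Lim_transform_eventually)
    show "\<forall>\<^sub>F x in at_top. F 0 + (LINT t:{0..x}|lborel. u t) = F x"
      using eventually_ge_at_top[of 0] by eventually_elim (drule split, linarith)
  qed
  have "((\<lambda>a. F 0 - (LINT t:{a..0}|lborel. u t)) \<longlongrightarrow> F 0 - (LINT t:{..0}|lborel. u t)) at_bot"
    by (intro tendsto_intros tendsto_set_lebesgue_integral_at_bot si) auto
  then have "(F \<longlongrightarrow> F 0 - (LINT t:{..0}|lborel. u t)) at_bot"
  proof (rule Lim_transform_eventually)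
    show "\<forall>\<^sub>F x in at_bot. F 0 - (LINT t:{x..0}|lborel. u t) = F x"
      using eventually_le_at_bot[of 0] by eventually_elim (drule split, linarith)
  qed
  then have 2: "(F \<longlongrightarrow> 0) at_bot" by (simp add: F_def)
  show thesis using that D 1 2 by blast
qed

section \<open>Monotone transport in dimension one\<close>

lemma positive_derivative_imp_between_limits:
  fixes G v :: "real \<Rightarrow> real"
  assumes "\<And>x. (G has_real_derivative v x) (at x)" "\<And>x. v x > 0"
    and "(G \<longlongrightarrow> a) at_bot" "(G \<longlongrightarrow> b) at_top"
  shows "strict_mono G" "a < G x" "G x < b"
proof -
  show sm: "strict_mono G"
    using assms(1,2) by (intro strict_monoI) (metis DERIV_pos_imp_increasing)
  \<comment> \<open>Passing to the limit only gives a weak bound; taking it one unit away and using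
    strict monotonicity makes it strict at x.\<close>
  have "a \<le> G (x-1)"
    using assms(3)
  proof (rule tendsto_upperbound)
    show "\<forall>\<^sub>F y in at_bot. G y \<le> G (x-1)"
      using eventually_le_at_bot[of "x-1"]
      by eventually_elim (use sm in \<open>simp add: strict_mono_less_eq\<close>)
  qed simp
  then show "a < G x" using strict_monoD[OF sm, of "x-1" x] by simp
  have "G (x+1) \<le> b"
    using assms(4)
  proof (rule tendsto_lowerbound)
    show "\<forall>\<^sub>F y in at_top. G (x+1) \<le> G y"
      using eventually_ge_at_top[of "x+1"]
      by eventually_elim (use sm in \<open>simp add: strict_mono_less_eq\<close>)
  qed simp
  then show "G x < b" using strict_monoD[OF sm, of x "x+1"] by simp
qed

text \<open>The map is the inverse of the distribution function of \<open>u\<close> composed with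
  that of \<open>v\<close>; equal masses put every value of the latter in the range of the former.
  The conclusion is mass preservation in differential form,
  \<open>S' * u (S x) = v x\<close>.\<close>

lemma monotone_transport_map:
  fixes u v :: "real \<Rightarrow> real"
  assumes u: "continuous_on UNIV u" "integrable lborel u" "\<And>x. u x > 0"
    and v: "continuous_on UNIV v" "integrable lborel v" "\<And>x. v x > 0"
    and mass: "integral\<^sup>L lborel u = integral\<^sup>L lborel v"
  obtains S where "\<And>x. (S has_real_derivative v x / u (S x)) (at x)"
proof -
  obtain F where F: "\<And>x. (F has_real_derivative u x) (at x)"
    "(F \<longlongrightarrow> 0) at_bot" "(F \<longlongrightarrow> integral\<^sup>L lborel u) at_top"
    using continuous_integrable_antiderivative[OF u(1,2)] by metis
  obtain G where G: "\<And>x. (G has_real_derivative v x) (at x)"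
    "(G \<longlongrightarrow> 0) at_bot" "(G \<longlongrightarrow> integral\<^sup>L lborel v) at_top"
    using continuous_integrable_antiderivative[OF v(1,2)] by metis
  let ?m = "integral\<^sup>L lborel u"
  note F' = positive_derivative_imp_between_limits[OF F(1) u(3) F(2,3)]
  note G' = positive_derivative_imp_between_limits[OF G(1) v(3) G(2,3), folded mass]
  have inj: "inj F" using F'(1) by (rule strict_mono_imp_inj_on)
  have cont: "isCont F x" for x using F(1) DERIV_isCont by blast
  have surj: "F (inv F y) = y" if y: "0 < y" "y < ?m" for y
  proof -
    obtain a where a: "F a < y"
      using order_tendstoD(2)[OF F(2) y(1)] by (auto simp: eventually_at_bot_linorder)
    obtain b where b: "y < F b"
      using order_tendstoD(1)[OF F(3) y(2)] by (auto simp: eventually_at_top_linorder)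
    have "a < b" using a b F'(1) by (meson order.strict_trans strict_mono_less)
    then have "\<exists>x. a \<le> x \<and> x \<le> b \<and> F x = y"
      using a b cont by (intro IVT) auto
    then show ?thesis by (metis f_inv_into_f rangeI)
  qed
  have "((\<lambda>x. inv F (G x)) has_real_derivative v x / u (inv F (G x))) (at x)" for x
  proof -
    define y where "y = inv F (G x)"
    have y: "F y = G x" unfolding y_def by (rule surj) (use G' in auto)
    have "isCont (inv F) (F y)"
      by (rule isCont_inverse_function[of 1]) (use inj cont in auto)
    then have "(inv F has_real_derivative inverse (u y)) (at (G x))"
      unfolding y
      by (intro DERIV_inverse_function[where f = F and a = 0 and b = ?m])
        (use surj G' F(1) u(3)[of y] in \<open>auto simp: y_def\<close>)
    from DERIV_chain2[OF this G(1)] show ?thesis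
      by (simp add: y_def field_simps)
  qed
  then show thesis by (rule that)
qed

text \<open>This is the vanishing of the integral of an exact derivative. A primitive of
  \<open>D\<close> minus \<open>B\<close> is nondecreasing and its limits are 0 and the integral of
  \<open>D\<close>; comparing primitives avoids any integrability claim on
  \<open>B'\<close>.\<close>

lemma integral_nonneg_of_ge_derivative:
  fixes B B' D :: "real \<Rightarrow> real"
  assumes cont: "continuous_on UNIV D" and int: "integrable lborel D"
    and B: "\<And>x. (B has_real_derivative B' x) (at x)" and le: "\<And>x. B' x \<le> D x"
    and lim: "(B \<longlongrightarrow> 0) at_top" "(B \<longlongrightarrow> 0) at_bot"
  shows "0 \<le> integral\<^sup>L lborel D"
proof -
  obtain F where F: "\<And>x. (F has_real_derivative D x) (at x)"
    "(F \<longlongrightarrow> 0) at_bot" "(F \<longlongrightarrow> integral\<^sup>L lborel D) at_top"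
    using continuous_integrable_antiderivative[OF cont int] by metis
  have mono: "F a - B a \<le> F b - B b" if "a \<le> b" for a b
    using that
  proof (rule DERIV_nonneg_imp_nondecreasing)
    show "\<exists>y. ((\<lambda>x. F x - B x) has_real_derivative y) (at x) \<and> 0 \<le> y" for x
      using F(1) B le[of x] by (intro exI[of _ "D x - B' x"]) (auto intro!: derivative_eq_intros)
  qed
  have bot: "((\<lambda>x. F x - B x) \<longlongrightarrow> 0 - 0) at_bot" by (intro tendsto_intros F lim)
  have top: "((\<lambda>x. F x - B x) \<longlongrightarrow> integral\<^sup>L lborel D - 0) at_top" by (intro tendsto_intros F lim)
  have "0 - 0 \<le> F 0 - B 0"
    using bot by (rule tendsto_upperbound) (auto intro!: eventually_mono[OF eventually_le_at_bot[of 0]] mono)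
  also have "\<dots> \<le> integral\<^sup>L lborel D - 0"
    using top by (rule tendsto_lowerbound) (auto intro!: eventually_mono[OF eventually_ge_at_top[of 0]] mono)
  finally show ?thesis by simp
qed

section \<open>The convexity constant\<close>

text \<open>With \<open>s = 1 + x\<^sup>2\<close> the right side is the second derivative of the
  potential in the coordinate \<open>Y\<close>. Weighted AM-GM with weights
  \<open>\<alpha> - 1\<close> and \<open>2 - \<alpha>\<close> bounds it below, as long as both are
  nonnegative.\<close>

lemma rho_le:
  fixes s :: real
  assumes "1 < \<alpha>" "\<alpha> < \<beta>" "1 \<le> s"
  shows "rho \<beta> \<alpha> \<le> (2*\<beta> - \<alpha>) * (s powr (\<alpha> - 2) * ((\<alpha> - 1) * s + (2 - \<alpha>)))"
proof -
  consider "\<alpha> < 3/2" | "3/2 \<le> \<alpha>" "\<alpha> \<le> 2" | "2 < \<alpha>" by linarith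
  then have "(if \<alpha> < 3/2 then ((\<alpha> - 1) / (2 - \<alpha>)) powr (3 - 2*\<alpha>) else 1)
      \<le> s powr (\<alpha> - 2) * ((\<alpha> - 1) * s + (2 - \<alpha>))"
  proof cases
    case 1
    \<comment> \<open>AM-GM is applied to \<open>q * s\<close> and \<open>1 / q\<close>: this q
      swaps the two weights, so the arithmetic mean is exactly the linear factor, while the
      geometric mean cancels \<open>s powr (\<alpha> - 2)\<close>. Equality holds at
      \<open>s = 1 / q\<^sup>2\<close>, which exceeds 1 as \<open>q < 1\<close> here.\<close>
    define q where "q = (\<alpha> - 1) / (2 - \<alpha>)"
    have q: "q > 0" using 1 assms by (simp add: q_def)
    have "q powr (3 - 2*\<alpha>) = s powr (\<alpha> - 2) * ((q * s) powr (2 - \<alpha>) * inverse q powr (\<alpha> - 1))"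
    proof -
      have "s powr (\<alpha> - 2) * s powr (2 - \<alpha>) = 1"
        using assms by (simp add: powr_add[symmetric])
      moreover have "q powr (2 - \<alpha>) * inverse q powr (\<alpha> - 1) = q powr (3 - 2*\<alpha>)"
        using q by (simp add: powr_minus[symmetric] inverse_powr powr_add[symmetric])
      ultimately show ?thesis using q assms by (simp add: powr_mult algebra_simps)
    qed
    also have "(q * s) powr (2 - \<alpha>) * inverse q powr (\<alpha> - 1)
        \<le> (2 - \<alpha>) * (q * s) + (\<alpha> - 1) * inverse q"
      using 1 assms q by (intro Youngs_inequality_0) auto
    also have "\<dots> = (\<alpha> - 1) * s + (2 - \<alpha>)"
    proof -
      have "(2 - \<alpha>) * q = \<alpha> - 1" "(\<alpha> - 1) * inverse q = 2 - \<alpha>"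
        using 1 assms by (auto simp: q_def)
      then show ?thesis by (simp add: mult.assoc[symmetric])
    qed
    finally show ?thesis using 1 by (simp add: q_def mult_left_mono)
  next
    case 2
    \<comment> \<open>Now the minimum over \<open>s \<ge> 1\<close> is at the endpoint 1, so AM-GM
      is applied to s and 1, leaving a nonnegative power of s.\<close>
    have "s powr (\<alpha> - 1) * 1 powr (2 - \<alpha>) \<le> (\<alpha> - 1) * s + (2 - \<alpha>) * 1"
      using 2 assms by (intro Youngs_inequality_0) auto
    then have "s powr (\<alpha> - 2) * s powr (\<alpha> - 1) \<le> s powr (\<alpha> - 2) * ((\<alpha> - 1) * s + (2 - \<alpha>))"
      by (intro mult_left_mono) auto
    moreover have "s powr (\<alpha> - 2) * s powr (\<alpha> - 1) = s powr (2*\<alpha> - 3)"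
      by (simp add: powr_add[symmetric])
    moreover have "1 \<le> s powr (2*\<alpha> - 3)" using 2 assms by (intro ge_one_powr_ge_zero) auto
    ultimately show ?thesis using 2 by simp
  next
    case 3
    \<comment> \<open>The weight \<open>2 - \<alpha>\<close> is negative here, but each of the two
      factors is at least 1.\<close>
    have "0 \<le> (\<alpha> - 1) * (s - 1)" using assms by simp
    then have "1 \<le> (\<alpha> - 1) * s + (2 - \<alpha>)" by (simp add: algebra_simps)
    then have "1 * 1 \<le> s powr (\<alpha> - 2) * ((\<alpha> - 1) * s + (2 - \<alpha>))"
      using 3 assms(3) by (intro mult_mono ge_one_powr_ge_zero) simp_all
    then show ?thesis using 3 by simp
  qed
  then have "(2*\<beta> - \<alpha>) * (if \<alpha> < 3/2 then ((\<alpha> - 1) / (2 - \<alpha>)) powr (3 - 2*\<alpha>) else 1)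
      \<le> (2*\<beta> - \<alpha>) * (s powr (\<alpha> - 2) * ((\<alpha> - 1) * s + (2 - \<alpha>)))"
    using assms by (intro mult_left_mono) auto
  then show ?thesis by (simp add: rho_def split: if_splits)
qed

lemma rho_pos: "1 < \<alpha> \<Longrightarrow> \<alpha> < \<beta> \<Longrightarrow> 0 < rho \<beta> \<alpha>"
  by (auto simp: rho_def)

section \<open>Limit and growth of y ln y\<close>

text \<open>The case \<open>x = 0\<close> matters, since both the function and its total mass may
  vanish; there the term is \<open>- ln (n + 1) / (n + 1)\<close>, and the limit agrees with
  \<open>ln 0 = 0\<close>.\<close>

lemma mult_ln_tendsto:
  fixes x :: real
  assumes "0 \<le> x"
  shows "((\<lambda>n. (x + 1 / real (Suc n)) * ln (x + 1 / real (Suc n))) \<longlonglongrightarrow> x * ln x)"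
proof (cases "x = 0")
  case True
  have "((\<lambda>n. - (ln (real (Suc n)) / real (Suc n))) \<longlonglongrightarrow> - 0)"
    by (intro tendsto_minus filterlim_compose[OF ln_x_over_x_tendsto_0]
        filterlim_compose[OF filterlim_real_sequentially] filterlim_Suc)
  then show ?thesis using True by (simp add: ln_div)
next
  case False
  have "(\<lambda>n. x + 1 / real (Suc n)) \<longlonglongrightarrow> x + 0"
    by (intro tendsto_intros LIMSEQ_Suc[OF lim_1_over_n])
  with False show ?thesis by (auto intro!: tendsto_intros)
qed

text \<open>A crude bound for dominated convergence, obtained from \<open>ln z \<le> z - 1\<close>
  at y and at 1/y.\<close>

lemma abs_mult_ln_le:
  fixes y :: real
  assumes "0 \<le> y"
  shows "\<bar>y * ln y\<bar> \<le> 1 + y\<^sup>2"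
proof (cases "y = 0")
  case False
  then have y: "y > 0" using assms by simp
  have "y * ln y \<le> y * y" using ln_le_minus_one[OF y] y by (intro mult_left_mono) auto
  moreover have "y * (- ln y) \<le> y * (1/y)"
    using ln_le_minus_one[of "1/y"] y by (intro mult_left_mono) (auto simp: ln_div)
  ultimately have "y * ln y \<le> y\<^sup>2" "- (y * ln y) \<le> 1" using y by (auto simp: power2_eq_square)
  then show ?thesis using zero_le_power2[of y] by linarith
qed simp

section \<open>Powers of 1 + x^2 and the density\<close>

lemma one_plus_square_pos [simp]: "0 < 1 + (x::real)\<^sup>2" "1 + (x::real)\<^sup>2 \<noteq> 0"
  by (simp_all add: add_pos_nonneg add_nonneg_eq_0_iff)

lemma has_real_derivative_one_plus_square_powr:
  "((\<lambda>x::real. (1 + x\<^sup>2) powr r) has_real_derivative 2 * r * x * (1 + x\<^sup>2) powr (r - 1)) (at x)"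
  by (rule derivative_eq_intros DERIV_powr refl | simp)+

lemma continuous_one_plus_square_powr:
  "continuous_on A (\<lambda>x::real. (1 + x\<^sup>2) powr r)"
  by (intro continuous_intros) simp

lemma one_plus_square_powr_tendsto_0:
  fixes r :: real
  assumes "r < 0"
  shows "((\<lambda>x::real. (1 + x\<^sup>2) powr r) \<longlongrightarrow> 0) at_top"
    and "((\<lambda>x::real. (1 + x\<^sup>2) powr r) \<longlongrightarrow> 0) at_bot"
  by (intro tendsto_neg_powr assms filterlim_tendsto_add_at_top[OF tendsto_const]
        filterlim_pow_at_top filterlim_pow_at_bot_even filterlim_ident; simp)+

lemma C_beta_pos:
  assumes "\<beta> > 1/2"
  shows "0 < C_beta \<beta>"
proof -
  have "0 < (\<integral>x. (1 + x\<^sup>2) powr (-\<beta>) \<partial>(lborel::real measure))"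
  proof -
    obtain F where F: "\<And>x. (F has_real_derivative (1 + x\<^sup>2) powr (-\<beta>)) (at x)"
      "(F \<longlongrightarrow> 0) at_bot" "(F \<longlongrightarrow> (\<integral>x. (1 + x\<^sup>2) powr (-\<beta>) \<partial>lborel)) at_top"
      using continuous_integrable_antiderivative[OF continuous_one_plus_square_powr
          integrable_one_plus_square_powr[OF assms]] by metis
    \<comment> \<open>A strictly increasing primitive separates its two limits, which are 0 and the
      integral.\<close>
    have "0 < F 0" "F 0 < (\<integral>x. (1 + x\<^sup>2) powr (-\<beta>) \<partial>lborel)"
      by (rule positive_derivative_imp_between_limits[OF F(1) _ F(2,3)]; simp)+
    then show ?thesis by simp
  qed
  then show ?thesis by (simp add: C_beta_def)
qed

lemma f_beta_density:
  assumes "\<beta> > 1/2"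
  shows "continuous_on A (f_beta \<beta>)" "0 < f_beta \<beta> x" "integrable lborel (f_beta \<beta>)"
    "integral\<^sup>L lborel (f_beta \<beta>) = 1"
proof -
  show "continuous_on A (f_beta \<beta>)"
    unfolding f_beta_def by (intro continuous_intros) simp
  show "0 < f_beta \<beta> x" using C_beta_pos[OF assms] by (simp add: f_beta_def)
  show "integrable lborel (f_beta \<beta>)" unfolding f_beta_def
    by (intro integrable_mult_right integrable_one_plus_square_powr assms)
  show "integral\<^sup>L lborel (f_beta \<beta>) = 1"
    using C_beta_pos[OF assms] unfolding f_beta_def by (simp add: C_beta_def)
qed

section \<open>Strong convexity of the potential\<close>

text \<open>The derivative is nonpositive to the left of x and nonnegative to the right. This yields
  a convexity inequality in the coordinate \<open>Y\<close> while working in the variable x, without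
  inverting \<open>Y\<close>.\<close>

lemma minimum_if_derivative_changes_sign:
  fixes h W Q :: "real \<Rightarrow> real"
  assumes "\<And>s. (h has_real_derivative W s * (Q s - Q x)) (at s)" "\<And>s. 0 \<le> W s" "mono Q"
  shows "h x \<le> h s"
proof (cases "x \<le> s")
  case True
  then show ?thesis
    by (rule DERIV_nonneg_imp_nondecreasing)
      (use assms(1,2) monoD[OF assms(3)] in \<open>fastforce intro!: mult_nonneg_nonneg\<close>)
next
  case False
  then have "s \<le> x" by simp
  then show ?thesis
    by (rule DERIV_nonpos_imp_nonincreasing)
      (use assms(1,2) monoD[OF assms(3)] in \<open>fastforce intro!: mult_nonneg_nonpos\<close>)
qed

text \<open>This is \<open>V(b) - V(a) \<ge> V'(a) (b - a) + \<rho>/2 (b - a)\<^sup>2\<close> at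
  \<open>a = Y x\<close>, \<open>b = Y s\<close>, with everything written in the original
  variable.\<close>

lemma log_potential_strongly_convex:
  fixes \<alpha> \<beta> x s :: real
  assumes ab: "1 < \<alpha>" "\<alpha> < \<beta>"
    and Y: "\<And>x. (Y has_real_derivative (1 + x\<^sup>2) powr (-(\<alpha>/2))) (at x)"
  shows "(2*\<beta> - \<alpha>) * x * (1 + x\<^sup>2) powr (\<alpha>/2 - 1) * (Y s - Y x) + rho \<beta> \<alpha> / 2 * (Y s - Y x)\<^sup>2
     \<le> (\<beta> - \<alpha>/2) * (ln (1 + s\<^sup>2) - ln (1 + x\<^sup>2))"
proof -
  let ?r = "rho \<beta> \<alpha>" and ?W = "\<lambda>x::real. (1 + x\<^sup>2) powr (-(\<alpha>/2))"
  \<comment> \<open>Differentiation in \<open>Y\<close> is d/dx divided by \<open>?W\<close>. Thus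
    \<open>U\<close> is the potential up to a constant, \<open>P\<close> its derivative in
    \<open>Y\<close>, and monotonicity of \<open>Q\<close> expresses that the second derivative is
    at least \<open>rho \<beta> \<alpha>\<close>.\<close>
  define P where "P = (\<lambda>x::real. (2*\<beta> - \<alpha>) * (x * (1 + x\<^sup>2) powr (\<alpha>/2 - 1)))"
  define U where "U = (\<lambda>x::real. (\<beta> - \<alpha>/2) * ln (1 + x\<^sup>2))"
  define Q where "Q = (\<lambda>x. P x - ?r * Y x)"
  have U: "(U has_real_derivative ?W x * P x) (at x)" for x
  proof -
    have D: "(U has_real_derivative (\<beta> - \<alpha>/2) * (2 * x / (1 + x\<^sup>2))) (at x)"
      unfolding U_def by (auto intro!: derivative_eq_intros)
    have "?W x * P x = (2*\<beta> - \<alpha>) * x * (?W x * (1 + x\<^sup>2) powr (\<alpha>/2 - 1))"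
      by (simp add: P_def)
    also have "?W x * (1 + x\<^sup>2) powr (\<alpha>/2 - 1) = 1 / (1 + x\<^sup>2)"
      using powr_minus_divide[of "1 + x\<^sup>2" 1] by (simp flip: powr_add)
    also have "(2*\<beta> - \<alpha>) * x * (1 / (1 + x\<^sup>2)) = (\<beta> - \<alpha>/2) * (2 * x / (1 + x\<^sup>2))"
      by (simp flip: distrib_right add: left_diff_distrib diff_divide_distrib)
    finally have "?W x * P x = (\<beta> - \<alpha>/2) * (2 * x / (1 + x\<^sup>2))" .
    then show ?thesis using D by (simp only:)
  qed
  have "mono Q"
  proof (rule monoI)
    fix a b :: real assume "a \<le> b"
    then show "Q a \<le> Q b"
    proof (rule DERIV_nonneg_imp_nondecreasing)
      fix x :: real
      let ?s = "1 + x\<^sup>2"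
      let ?D = "(2*\<beta> - \<alpha>) * (?s powr (\<alpha>/2 - 2) * ((\<alpha> - 1) * ?s + (2 - \<alpha>)))"
      have e: "?s powr (\<alpha>/2 - 1) = ?s powr (\<alpha>/2 - 2) * ?s"
        using powr_add[of ?s "\<alpha>/2 - 2" 1] by simp
      have "(P has_real_derivative
          (2*\<beta> - \<alpha>) * (?s powr (\<alpha>/2 - 1) + x * (2 * (\<alpha>/2 - 1) * x * ?s powr (\<alpha>/2 - 1 - 1)))) (at x)"
        unfolding P_def
        by (rule derivative_eq_intros has_real_derivative_one_plus_square_powr refl | simp)+
      also have "(2*\<beta> - \<alpha>) * (?s powr (\<alpha>/2 - 1) + x * (2 * (\<alpha>/2 - 1) * x * ?s powr (\<alpha>/2 - 1 - 1))) = ?D"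
        unfolding e by (simp add: power2_eq_square algebra_simps)
      finally have D: "(Q has_real_derivative ?D - ?r * ?W x) (at x)"
        unfolding Q_def using Y by (auto intro!: derivative_eq_intros)
      have "?r * ?W x \<le> ((2*\<beta> - \<alpha>) * (?s powr (\<alpha> - 2) * ((\<alpha> - 1) * ?s + (2 - \<alpha>)))) * ?W x"
        by (intro mult_right_mono rho_le ab) auto
      also have "\<dots> = (2*\<beta> - \<alpha>) * ((?s powr (\<alpha> - 2) * ?W x) * ((\<alpha> - 1) * ?s + (2 - \<alpha>)))"
        by (simp only: mult_ac)
      also have "?s powr (\<alpha> - 2) * ?W x = ?s powr (\<alpha>/2 - 2)"
        by (simp add: powr_add[symmetric])
      finally show "\<exists>y. (Q has_real_derivative y) (at x) \<and> 0 \<le> y" using D by force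
    qed
  qed
  \<comment> \<open>The claim is equivalent to \<open>h\<close> being minimal at x.\<close>
  define h where "h = (\<lambda>s. U s - P x * Y s - ?r / 2 * (Y s - Y x)\<^sup>2)"
  have "(h has_real_derivative ?W s * (Q s - Q x)) (at s)" for s
    unfolding h_def
    by (rule derivative_eq_intros U Y refl | simp add: Q_def algebra_simps)+
  then have "h x \<le> h s"
    by (rule minimum_if_derivative_changes_sign) (use \<open>mono Q\<close> in auto)
  then show ?thesis by (simp add: h_def P_def U_def algebra_simps)
qed

section \<open>Entropy against Fisher information for positive densities\<close>

lemma entropy_le_fisher_normalized:
  fixes \<alpha> \<beta> M :: real and h h' :: "real \<Rightarrow> real"
  assumes ab: "1 < \<alpha>" "\<alpha> < \<beta>"
    and h: "\<And>x. (h has_real_derivative h' x) (at x)" "continuous_on UNIV h'"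
      "\<And>x. 0 < h x" "\<And>x. h x \<le> M"
    and int: "integrable lborel (\<lambda>x. h x * f_beta \<beta> x)"
      "(\<integral>x. h x * f_beta \<beta> x \<partial>lborel) = 1"
      "integrable lborel (\<lambda>x. h x * ln (h x) * f_beta \<beta> x)"
      "integrable lborel (\<lambda>x. (1 + x\<^sup>2) powr \<alpha> * ((h' x)\<^sup>2 / h x) * f_beta \<beta> x)"
  shows "(\<integral>x. h x * ln (h x) * f_beta \<beta> x \<partial>lborel)
    \<le> 1 / (2 * rho \<beta> \<alpha>) * (\<integral>x. (1 + x\<^sup>2) powr \<alpha> * ((h' x)\<^sup>2 / h x) * f_beta \<beta> x \<partial>lborel)"
proof -
  let ?f = "f_beta \<beta>" and ?W = "\<lambda>x::real. (1 + x\<^sup>2) powr (-(\<alpha>/2))" and ?r = "rho \<beta> \<alpha>"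
  let ?J = "\<lambda>x. (1 + x\<^sup>2) powr \<alpha> * ((h' x)\<^sup>2 / h x) * ?f x"
  let ?P = "\<lambda>x. (2*\<beta> - \<alpha>) * x * (1 + x\<^sup>2) powr (\<alpha>/2 - 1)"
  \<comment> \<open>\<open>m\<close> is the density of the law of X in the coordinate
    \<open>Y\<close>, written as a function of x; hence \<open>m x * ?W x = ?f x\<close>
    below.\<close>
  define m where "m = (\<lambda>x. C_beta \<beta> * (1 + x\<^sup>2) powr (\<alpha>/2 - \<beta>))"
  have b: "\<beta> > 1/2" using ab by simp
  note f = f_beta_density[OF b]
  have r: "?r > 0" using ab by (rule rho_pos)
  have ch: "continuous_on UNIV h" using h(1) by (meson DERIV_isCont continuous_at_imp_continuous_on)
  obtain S where S: "\<And>x. (S has_real_derivative h x * ?f x / ?f (S x)) (at x)"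
    using monotone_transport_map[OF f(1,3,2) _ int(1)] h(3) f ch int(2)
    by (auto intro!: continuous_intros)
  \<comment> \<open>This is where \<open>\<alpha> > 1\<close> makes the range of \<open>Y\<close>
    bounded, and with it the displacement \<open>\<theta>\<close>.\<close>
  have W: "1/2 < \<alpha>/2" using ab by simp
  obtain Y where Y: "\<And>x. (Y has_real_derivative ?W x) (at x)"
    "(Y \<longlongrightarrow> 0) at_bot" "(Y \<longlongrightarrow> integral\<^sup>L lborel ?W) at_top"
    using continuous_integrable_antiderivative[OF continuous_one_plus_square_powr
          integrable_one_plus_square_powr[OF W]] by metis
  let ?K = "integral\<^sup>L lborel ?W"
  have Yb: "0 < Y x" "Y x < ?K" for x
    by (rule positive_derivative_imp_between_limits[OF Y(1) _ Y(2,3)]; simp)+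
  define \<theta> where "\<theta> = (\<lambda>x. Y (S x) - Y x)"
  have \<theta>b: "\<bar>\<theta> x\<bar> \<le> ?K" for x
    using Yb[of x] Yb[of "S x"] unfolding \<theta>_def by linarith
  have d\<theta>: "(\<theta> has_real_derivative ?W (S x) * (h x * ?f x / ?f (S x)) - ?W x) (at x)" for x
    unfolding \<theta>_def by (rule derivative_intros DERIV_chain2[OF Y(1) S] Y(1))+
  have mW: "m x * ?W x = ?f x" for x
    by (simp add: m_def f_beta_def powr_add[symmetric] mult.assoc)
  have mpos: "0 < m x" for x using C_beta_pos[OF b] by (simp add: m_def)
  have dm: "(m has_real_derivative - (?P x * ?f x)) (at x)" for x
  proof -
    have "(m has_real_derivative C_beta \<beta> * (2 * (\<alpha>/2 - \<beta>) * x * (1 + x\<^sup>2) powr (\<alpha>/2 - \<beta> - 1))) (at x)"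
      unfolding m_def by (rule DERIV_cmult has_real_derivative_one_plus_square_powr)+
    also have "(1 + x\<^sup>2) powr (\<alpha>/2 - \<beta> - 1) = (1 + x\<^sup>2) powr (\<alpha>/2 - 1) * (1 + x\<^sup>2) powr (-\<beta>)"
      by (simp add: powr_add[symmetric] algebra_simps)
    finally show ?thesis by (simp add: f_beta_def algebra_simps)
  qed
  define B where "B = (\<lambda>x. - (m x * h x * \<theta> x))"
  define B' where "B' = (\<lambda>x. ?P x * ?f x * h x * \<theta> x - m x * h' x * \<theta> x
      - m x * h x * (?W (S x) * (h x * ?f x / ?f (S x)) - ?W x))"
  have dB: "(B has_real_derivative B' x) (at x)" for x
    unfolding B_def
    by (rule derivative_eq_intros dm h(1) d\<theta> refl | simp add: B'_def algebra_simps)+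
  have le: "B' x \<le> 1 / (2 * ?r) * ?J x - h x * ln (h x) * ?f x" for x
  proof -
    \<comment> \<open>\<open>\<tau>\<close> is the derivative of the transport map read in the
      coordinate \<open>Y\<close>, so that the derivative of \<open>\<theta>\<close> is
      \<open>?W x * (\<tau> - 1)\<close> and the change of variables formula becomes
      \<open>h x = \<tau> * m (S x) / m x\<close>.\<close>
    define \<tau> where "\<tau> = ?W (S x) * (h x * ?f x / ?f (S x)) / ?W x"
    have \<tau>: "\<tau> > 0" using h(3) f(2) by (simp add: \<tau>_def)
    have "h x = \<tau> * (m (S x) / m x)"
      unfolding \<tau>_def mW[symmetric] using mpos[of x] mpos[of "S x"] by (simp add: field_simps)
    then have "ln (h x) = ln \<tau> + (ln (m (S x)) - ln (m x))"
      using \<tau> mpos[of x] mpos[of "S x"] by (simp add: ln_mult ln_div)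
    also have "ln (m (S x)) - ln (m x) = - ((\<beta> - \<alpha>/2) * (ln (1 + (S x)\<^sup>2) - ln (1 + x\<^sup>2)))"
      using C_beta_pos[OF b] by (simp add: m_def ln_mult ln_powr algebra_simps)
    also have "\<dots> \<le> - (?P x * \<theta> x + ?r / 2 * (\<theta> x)\<^sup>2)"
      using log_potential_strongly_convex[OF ab Y(1), of x "S x"] unfolding \<theta>_def by linarith
    finally have "ln (h x) \<le> (\<tau> - 1) - (?P x * \<theta> x + ?r / 2 * (\<theta> x)\<^sup>2)"
      using ln_le_minus_one[OF \<tau>] by linarith
    then have "h x * ?f x * ln (h x) \<le> h x * ?f x * ((\<tau> - 1) - (?P x * \<theta> x + ?r / 2 * (\<theta> x)\<^sup>2))"
      using h(3)[of x] f(2)[of x] by (intro mult_left_mono) auto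
    moreover have "- (m x * h' x * \<theta> x) \<le> ?f x * (?r / 2 * h x * (\<theta> x)\<^sup>2) + 1 / (2 * ?r) * ?J x"
    proof -
      \<comment> \<open>The shift is chosen so that the cross term is
        \<open>h' x * \<theta> x / ?W x\<close>; multiplied by \<open>?f x\<close> it becomes
        \<open>m x * h' x * \<theta> x\<close>, and the constant term becomes the Fisher
        integrand.\<close>
      have "0 \<le> ?r * h x / 2 * (\<theta> x + h' x / (?W x * ?r * h x))\<^sup>2"
        using r h(3)[of x] by simp
      also have "\<dots> = ?r / 2 * h x * (\<theta> x)\<^sup>2 + h' x * \<theta> x / ?W x + (1 / (?W x)\<^sup>2) * (h' x)\<^sup>2 / (2 * ?r * h x)"
      proof -
        have "a * k / 2 * (t + d / (w * a * k))\<^sup>2 = a / 2 * k * t\<^sup>2 + d * t / w + (1 / w\<^sup>2) * d\<^sup>2 / (2 * a * k)"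
          if "0 < a" "0 < k" "0 < w" for a k t d w :: real
          using that by (simp add: power2_eq_square field_simps)
        then show ?thesis using r h(3)[of x] by simp
      qed
      also have "1 / (?W x)\<^sup>2 = (1 + x\<^sup>2) powr \<alpha>"
        by (simp add: powr_minus_divide power2_eq_square powr_add[symmetric])
      finally have "?f x * (- (h' x * \<theta> x / ?W x)) \<le>
          ?f x * (?r / 2 * h x * (\<theta> x)\<^sup>2 + (1 + x\<^sup>2) powr \<alpha> * (h' x)\<^sup>2 / (2 * ?r * h x))"
        using f(2)[of x] by (intro mult_left_mono) auto
      moreover have "?f x * (- (h' x * \<theta> x / ?W x)) = - (m x * h' x * \<theta> x)"
        unfolding mW[symmetric] by simp
      moreover have "?f x * ((1 + x\<^sup>2) powr \<alpha> * (h' x)\<^sup>2 / (2 * ?r * h x)) = 1 / (2 * ?r) * ?J x"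
        by simp
      ultimately show ?thesis by (simp only: distrib_left)
    qed
    moreover have "m x * h x * (?W (S x) * (h x * ?f x / ?f (S x)) - ?W x) = h x * ?f x * (\<tau> - 1)"
      unfolding \<tau>_def mW[of x, symmetric] by (simp add: field_simps)
    ultimately show ?thesis unfolding B'_def by (simp add: algebra_simps)
  qed
  \<comment> \<open>The bounds on \<open>h\<close> and \<open>\<theta>\<close> leave only
    \<open>m\<close>, whose exponent \<open>\<alpha>/2 - \<beta>\<close> is negative, so there are
    no boundary terms.\<close>
  have Bb: "norm (B x) \<le> m x * (M * ?K)" for x
  proof -
    have "\<bar>h x * \<theta> x\<bar> \<le> M * ?K"
      unfolding abs_mult using h(3)[of x] h(4)[of x] \<theta>b[of x] by (intro mult_mono) auto
    then show ?thesis using mpos[of x] unfolding B_def by (simp add: abs_mult mult.assoc)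
  qed
  have "((\<lambda>x. m x * (M * ?K)) \<longlongrightarrow> C_beta \<beta> * 0 * (M * ?K)) at_top"
    "((\<lambda>x. m x * (M * ?K)) \<longlongrightarrow> C_beta \<beta> * 0 * (M * ?K)) at_bot"
    unfolding m_def by (intro tendsto_intros one_plus_square_powr_tendsto_0; use ab in simp)+
  then have lim: "(B \<longlongrightarrow> 0) at_top" "(B \<longlongrightarrow> 0) at_bot"
    by (auto intro!: Lim_null_comparison[OF always_eventually[OF allI[OF Bb]]])
  have "0 \<le> (\<integral>x. 1 / (2 * ?r) * ?J x - h x * ln (h x) * ?f x \<partial>lborel)"
  proof (rule integral_nonneg_of_ge_derivative[OF _ _ dB le lim])
    show "continuous_on UNIV (\<lambda>x. 1 / (2 * ?r) * ?J x - h x * ln (h x) * ?f x)"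
      by (intro continuous_intros ch h(2) f(1)) (use h(3) r in \<open>auto simp: less_imp_neq[symmetric]\<close>)
    show "integrable lborel (\<lambda>x. 1 / (2 * ?r) * ?J x - h x * ln (h x) * ?f x)"
      by (intro Bochner_Integration.integrable_diff integrable_mult_right int)
  qed
  also have "\<dots> = 1 / (2 * ?r) * integral\<^sup>L lborel ?J - (\<integral>x. h x * ln (h x) * ?f x \<partial>lborel)"
    by (subst Bochner_Integration.integral_diff)
      (intro integrable_mult_right int, intro int, simp only: integral_mult_right_zero)
  finally show ?thesis by simp
qed

text \<open>Both sides are homogeneous of degree one in \<open>h\<close>, so dividing by the mass
  \<open>Z\<close> reduces to the normalized case; the term \<open>Z ln Z\<close> in
  \<open>Ent\<close> accounts for the logarithm of the factor.\<close>

lemma Ent_le_fisher: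
  fixes \<alpha> \<beta> M :: real and h h' :: "real \<Rightarrow> real"
  assumes ab: "1 < \<alpha>" "\<alpha> < \<beta>"
    and h: "\<And>x. (h has_real_derivative h' x) (at x)" "continuous_on UNIV h'"
      "\<And>x. 0 < h x" "\<And>x. h x \<le> M"
    and int: "integrable lborel (\<lambda>x. h x * f_beta \<beta> x)"
      "integrable lborel (\<lambda>x. h x * ln (h x) * f_beta \<beta> x)"
      "integrable lborel (\<lambda>x. (1 + x\<^sup>2) powr \<alpha> * ((h' x)\<^sup>2 / h x) * f_beta \<beta> x)"
    and Z: "0 < (\<integral>x. h x * f_beta \<beta> x \<partial>lborel)"
  shows "Ent (f_beta \<beta>) h
    \<le> 1 / (2 * rho \<beta> \<alpha>) * (\<integral>x. (1 + x\<^sup>2) powr \<alpha> * ((h' x)\<^sup>2 / h x) * f_beta \<beta> x \<partial>lborel)"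
proof -
  let ?f = "f_beta \<beta>"
  define Z where "Z = (\<integral>x. h x * ?f x \<partial>lborel)"
  have Zp: "Z > 0" using Z by (simp add: Z_def)
  define g where "g = (\<lambda>x. h x / Z)"
  define g' where "g' = (\<lambda>x. h' x / Z)"
  have 1: "(\<lambda>x. g x * ?f x) = (\<lambda>x. (1/Z) * (h x * ?f x))"
    by (simp add: g_def)
  have 2: "(\<lambda>x. g x * ln (g x) * ?f x) = (\<lambda>x. (1/Z) * (h x * ln (h x) * ?f x) - ln Z / Z * (h x * ?f x))"
    using h(3) Zp by (simp add: g_def ln_div fun_eq_iff less_imp_neq[symmetric] field_simps)
  have 3: "(\<lambda>x. (1 + x\<^sup>2) powr \<alpha> * ((g' x)\<^sup>2 / g x) * ?f x)
      = (\<lambda>x. (1/Z) * ((1 + x\<^sup>2) powr \<alpha> * ((h' x)\<^sup>2 / h x) * ?f x))"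
    using Zp by (simp add: g_def g'_def fun_eq_iff power2_eq_square field_simps)
  have "(\<integral>x. g x * ln (g x) * ?f x \<partial>lborel)
    \<le> 1 / (2 * rho \<beta> \<alpha>) * (\<integral>x. (1 + x\<^sup>2) powr \<alpha> * ((g' x)\<^sup>2 / g x) * ?f x \<partial>lborel)"
  proof (rule entropy_le_fisher_normalized[OF ab])
    show "(g has_real_derivative g' x) (at x)" for x
      unfolding g_def g'_def by (rule DERIV_cdivide h(1))+
    show "continuous_on UNIV g'"
      unfolding g'_def using Zp by (intro continuous_intros h(2)) auto
    show "0 < g x" for x using h(3) Zp by (simp add: g_def)
    show "g x \<le> M / Z" for x using h(4) Zp by (simp add: g_def divide_right_mono)
    show "integrable lborel (\<lambda>x. g x * ?f x)"
      unfolding 1 by (intro integrable_mult_right int)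
    show "(\<integral>x. g x * ?f x \<partial>lborel) = 1"
      unfolding 1 using Zp by (subst integral_mult_right_zero) (simp add: Z_def)
    show "integrable lborel (\<lambda>x. g x * ln (g x) * ?f x)"
      unfolding 2 by (intro Bochner_Integration.integrable_diff integrable_mult_right int)
    show "integrable lborel (\<lambda>x. (1 + x\<^sup>2) powr \<alpha> * ((g' x)\<^sup>2 / g x) * ?f x)"
      unfolding 3 by (intro integrable_mult_right int)
  qed
  also have "(\<integral>x. g x * ln (g x) * ?f x \<partial>lborel)
      = (1/Z) * (\<integral>x. h x * ln (h x) * ?f x \<partial>lborel) - ln Z / Z * Z"
    unfolding 2 by (subst Bochner_Integration.integral_diff)
      (intro integrable_mult_right int, intro integrable_mult_right int,
        simp only: integral_mult_right_zero Z_def)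
  also have "\<dots> = (1/Z) * Ent ?f h"
    using Zp by (simp add: Ent_def Z_def[symmetric] field_simps)
  also have "1 / (2 * rho \<beta> \<alpha>) * (\<integral>x. (1 + x\<^sup>2) powr \<alpha> * ((g' x)\<^sup>2 / g x) * ?f x \<partial>lborel)
     = (1/Z) * (1 / (2 * rho \<beta> \<alpha>) * (\<integral>x. (1 + x\<^sup>2) powr \<alpha> * ((h' x)\<^sup>2 / h x) * ?f x \<partial>lborel))"
    unfolding 3 integral_mult_right_zero by simp
  finally show ?thesis using Zp by (simp only: mult_le_cancel_left_pos[of "1/Z"] zero_less_divide_1_iff)
qed

section \<open>Regularization of the squared function and passage to the limit\<close>

theorem theorem3p1:
  fixes \<beta> \<alpha> :: real and \<phi> :: "real \<Rightarrow> real"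
  assumes "\<beta> > 1" and "1 < \<alpha>" and "\<alpha> < \<beta>"
    and "bounded (range \<phi>)" and "smooth_real \<phi>"
    and "finite_entropy (f_beta \<beta>) (\<lambda>x. (\<phi> x)\<^sup>2)"
  shows "ennreal (Ent (f_beta \<beta>) (\<lambda>x. (\<phi> x)\<^sup>2))
    \<le> ennreal (2 / rho \<beta> \<alpha>) *
       (\<integral>\<^sup>+x. ennreal ((1 + x\<^sup>2) powr \<alpha> * (deriv \<phi> x)\<^sup>2 * f_beta \<beta> x) \<partial>lborel)"
proof -
  let ?f = "f_beta \<beta>" and ?r = "rho \<beta> \<alpha>"
  let ?E = "\<lambda>x. (1 + x\<^sup>2) powr \<alpha> * (deriv \<phi> x)\<^sup>2 * ?f x"
  have b: "\<beta> > 1/2" using assms by simp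
  note f = f_beta_density[OF b]
  have r: "?r > 0" using assms by (intro rho_pos)
  have d\<phi>: "(\<phi> has_real_derivative deriv \<phi> x) (at x)" for x
    using assms(5)[unfolded smooth_real_def, rule_format, of 0 x]
    by (simp add: DERIV_deriv_iff_real_differentiable)
  \<comment> \<open>Instance 1 of smoothness says that the derivative is differentiable, hence
    continuous.\<close>
  have c\<phi>': "continuous_on UNIV (deriv \<phi>)"
    using assms(5)[unfolded smooth_real_def, rule_format, of 1]
    by (auto intro!: continuous_at_imp_continuous_on differentiable_imp_continuous_within)
  have c\<phi>: "continuous_on UNIV \<phi>"
    using d\<phi> by (meson DERIV_isCont continuous_at_imp_continuous_on)
  obtain K where K: "\<And>x. \<bar>\<phi> x\<bar> \<le> K"
    using assms(4) by (auto simp: bounded_iff)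
  have K2: "(\<phi> x)\<^sup>2 \<le> K\<^sup>2" for x
    using K[of x] by (metis abs_ge_zero power2_abs power_mono)
  have Enn: "0 \<le> ?E x" for x using f(2)[of x] by simp
  have mE: "?E \<in> borel_measurable borel"
    by (intro borel_measurable_continuous_onI continuous_intros c\<phi>' f(1)) simp
  show ?thesis
  \<comment> \<open>An infinite energy makes the right side infinite, as the factor is positive; a
    finite one permits Bochner integrals.\<close>
  proof (cases "(\<integral>\<^sup>+x. ennreal (?E x) \<partial>lborel) = \<infinity>")
    case True
    then show ?thesis using r by (simp add: ennreal_mult_top)
  next
    case False
    have iE: "integrable lborel ?E"
      using False mE Enn by (intro integrableI_nonneg) (auto simp: less_top[symmetric])
    \<comment> \<open>Since \<open>\<phi>\<close> may vanish, a positive constant is added to its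
      square so that the transport inequality applies.\<close>
    define e where "e = (\<lambda>n. 1 / real (Suc n))"
    have e: "0 < e n" "e n \<le> 1" for n by (auto simp: e_def)
    define h where "h = (\<lambda>n x. (\<phi> x)\<^sup>2 + e n)"
    have hpos: "0 < h n x" for n x using e by (simp add: h_def add_nonneg_pos)
    have hle: "h n x \<le> K\<^sup>2 + 1" for n x using K2[of x] e[of n] by (simp add: h_def)
    have ch: "continuous_on UNIV (h n)" for n
      unfolding h_def by (intro continuous_intros c\<phi>)
    have cl: "continuous_on UNIV (\<lambda>x. h n x * ln (h n x) * ?f x)" for n
      by (intro continuous_intros ch f(1)) (use hpos in \<open>auto simp: less_imp_neq[symmetric]\<close>)
    \<comment> \<open>This bounds \<open>\<bar>y ln y\<bar>\<close> for all \<open>y\<close> in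
      \<open>[0, K\<^sup>2 + 1]\<close>, uniformly in n.\<close>
    define D where "D = 1 + (K\<^sup>2 + 1)\<^sup>2"
    have hb: "\<bar>h n x * ln (h n x)\<bar> \<le> D" for n x
    proof -
      have "(h n x)\<^sup>2 \<le> (K\<^sup>2 + 1)\<^sup>2" using hpos[of n x] hle[of n x] by (intro power_mono) auto
      then show ?thesis using abs_mult_ln_le[OF less_imp_le[OF hpos[of n x]]] unfolding D_def by linarith
    qed
    have iD: "integrable lborel (\<lambda>x. c * ?f x)" for c by (intro integrable_mult_right f(3))
    have bd: "norm (h n x * ln (h n x) * ?f x) \<le> D * ?f x" for n x
      using hb[of n x] f(2)[of x] by (simp add: abs_mult mult_right_mono)
    have il: "integrable lborel (\<lambda>x. h n x * ln (h n x) * ?f x)" for n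
    proof (rule Bochner_Integration.integrable_bound[OF iD[of D]])
      show "AE x in lborel. norm (h n x * ln (h n x) * ?f x) \<le> norm (D * ?f x)"
        by (intro AE_I2 order_trans[OF bd]) simp
    qed (use cl in \<open>simp add: borel_measurable_continuous_onI\<close>)
    define Z where "Z = (\<integral>x. (\<phi> x)\<^sup>2 * ?f x \<partial>lborel)"
    have iZ: "integrable lborel (\<lambda>x. (\<phi> x)\<^sup>2 * ?f x)"
      using assms(6) by (simp add: finite_entropy_def)
    have Z0: "0 \<le> Z" unfolding Z_def using f(2) by (intro integral_nonneg_AE AE_I2) (simp add: less_imp_le)
    have hsplit: "(\<lambda>x. h n x * ?f x) = (\<lambda>x. (\<phi> x)\<^sup>2 * ?f x + e n * ?f x)" for n
      by (simp add: h_def algebra_simps)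
    have ih: "integrable lborel (\<lambda>x. h n x * ?f x)" for n
      unfolding hsplit by (intro Bochner_Integration.integrable_add iZ iD)
    have Zn: "(\<integral>x. h n x * ?f x \<partial>lborel) = Z + e n" for n
      unfolding hsplit by (subst Bochner_Integration.integral_add[OF iZ iD]) (simp add: Z_def f(4))
    \<comment> \<open>The Fisher integrand of \<open>h n\<close>. It is at most four times the
      energy integrand because \<open>(\<phi> x)\<^sup>2 \<le> h n x\<close>, and this 4 turns the
      constant \<open>1 / (2 * ?r)\<close> into \<open>2 / ?r\<close>.\<close>
    define J where "J = (\<lambda>n x. (1 + x\<^sup>2) powr \<alpha> * ((2 * \<phi> x * deriv \<phi> x)\<^sup>2 / h n x) * ?f x)"
    have J: "0 \<le> J n x" "J n x \<le> 4 * ?E x" for n x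
    proof -
      show "0 \<le> J n x" unfolding J_def using f(2)[of x] hpos[of n x] by simp
      have "(\<phi> x)\<^sup>2 * (deriv \<phi> x)\<^sup>2 \<le> h n x * (deriv \<phi> x)\<^sup>2"
        using e[of n] by (intro mult_right_mono) (auto simp: h_def)
      then have "(2 * \<phi> x * deriv \<phi> x)\<^sup>2 / h n x \<le> 4 * (deriv \<phi> x)\<^sup>2"
        using hpos[of n x] by (simp add: divide_le_eq power_mult_distrib mult_ac)
      then have "(1 + x\<^sup>2) powr \<alpha> * ((2 * \<phi> x * deriv \<phi> x)\<^sup>2 / h n x) * ?f x
          \<le> (1 + x\<^sup>2) powr \<alpha> * (4 * (deriv \<phi> x)\<^sup>2) * ?f x"
        using f(2)[of x] by (intro mult_right_mono mult_left_mono) auto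
      then show "J n x \<le> 4 * ?E x" by (simp add: J_def mult_ac)
    qed
    have cJ: "continuous_on UNIV (J n)" for n
      unfolding J_def by (intro continuous_intros c\<phi> c\<phi>' ch f(1)) (use hpos in \<open>auto simp: less_imp_neq[symmetric]\<close>)
    have iJ: "integrable lborel (J n)" for n
      using cJ J Enn
      by (intro Bochner_Integration.integrable_bound[OF integrable_mult_right[OF iE, of 4]])
        (auto intro!: borel_measurable_continuous_onI AE_I2 simp: abs_of_nonneg)
    have main: "Ent ?f (h n) \<le> 2 / ?r * integral\<^sup>L lborel ?E" for n
    proof -
      have "Ent ?f (h n) \<le> 1 / (2 * ?r) * integral\<^sup>L lborel (J n)"
        unfolding J_def
      proof (rule Ent_le_fisher[OF assms(2,3) _ _ hpos hle ih il])
        show "(h n has_real_derivative 2 * \<phi> x * deriv \<phi> x) (at x)" for x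
          unfolding h_def by (auto intro!: derivative_eq_intros d\<phi>)
        show "continuous_on UNIV (\<lambda>x. 2 * \<phi> x * deriv \<phi> x)"
          by (intro continuous_intros c\<phi> c\<phi>')
        show "0 < (\<integral>x. h n x * ?f x \<partial>lborel)" using Zn Z0 e by (simp add: add_nonneg_pos)
      qed (use iJ in \<open>simp add: J_def\<close>)
      also have "\<dots> \<le> 1 / (2 * ?r) * (\<integral>x. 4 * ?E x \<partial>lborel)"
        using r by (intro mult_left_mono integral_mono iJ integrable_mult_right iE J) auto
      also have "\<dots> = 2 / ?r * integral\<^sup>L lborel ?E"
        by (subst integral_mult_right_zero) simp
      finally show ?thesis .
    qed
    have "(\<lambda>n. \<integral>x. h n x * ln (h n x) * ?f x \<partial>lborel)
        \<longlonglongrightarrow> (\<integral>x. (\<phi> x)\<^sup>2 * ln ((\<phi> x)\<^sup>2) * ?f x \<partial>lborel)"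
    proof (rule integral_dominated_convergence[OF _ _ iD[of D]])
      show "(\<lambda>x. (\<phi> x)\<^sup>2 * ln ((\<phi> x)\<^sup>2) * ?f x) \<in> borel_measurable lborel"
        using assms(6) unfolding finite_entropy_def by (blast intro: borel_measurable_integrable)
      show "(\<lambda>x. h n x * ln (h n x) * ?f x) \<in> borel_measurable lborel" for n
        using il by (rule borel_measurable_integrable)
      show "AE x in lborel. (\<lambda>n. h n x * ln (h n x) * ?f x) \<longlonglongrightarrow> (\<phi> x)\<^sup>2 * ln ((\<phi> x)\<^sup>2) * ?f x"
        unfolding h_def e_def by (intro AE_I2 tendsto_mult_right mult_ln_tendsto) simp
    qed (use bd in auto)
    \<comment> \<open>The density has mass one, so the regularized mass is exactly
      \<open>Z + e n\<close>, and the same limit lemma covers the case \<open>Z = 0\<close>.\<close>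
    moreover have "(\<lambda>n. (Z + e n) * ln (Z + e n)) \<longlonglongrightarrow> Z * ln Z"
      unfolding e_def using Z0 by (rule mult_ln_tendsto)
    ultimately have "(\<lambda>n. Ent ?f (h n)) \<longlonglongrightarrow> Ent ?f (\<lambda>x. (\<phi> x)\<^sup>2)"
      unfolding Ent_def Zn Z_def[symmetric] by (rule tendsto_diff)
    then have "Ent ?f (\<lambda>x. (\<phi> x)\<^sup>2) \<le> 2 / ?r * integral\<^sup>L lborel ?E"
      by (rule LIMSEQ_le_const2) (use main in blast)
    then have "ennreal (Ent ?f (\<lambda>x. (\<phi> x)\<^sup>2)) \<le> ennreal (2 / ?r) * ennreal (integral\<^sup>L lborel ?E)"
      using r by (simp add: ennreal_mult'[symmetric] ennreal_leI)
    also have "ennreal (integral\<^sup>L lborel ?E) = (\<integral>\<^sup>+x. ennreal (?E x) \<partial>lborel)"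
      using iE Enn by (intro nn_integral_eq_integral[symmetric]) auto
    finally show ?thesis .
  qed
qed

end
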